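(* Let $\mathcal{P}=\{U_k(x)\}_{k=0}^\infty$, where $U_k$ is the $k$-th Chebyshev polynomial of the second kind. Then $$\mathscr{T}_k^{(n)}(\mathcal{P};x)=\frac{2^{2n-1}}{(2n)!}(1-x^2)^{n-1}$$ for all integers $n\ge 1$ and all $k\in\mathbb{N}$.
   Context: $\mathbb{N}=\{0,1,2,\dots\}$. For a sequence of polynomials $\mathcal{P}=\{P_k(x)\}_{k=0}^\infty$, the $k$-th extended Turán expression (of order $n$) is $$\mathscr{T}_k^{(n)}(\mathcal{P};x)=\sum_{j=0}^{2n}\frac{(-1)^{n+j}}{(2n)!}\binom{2n}{j}P_{j+k}(x)P_{2n+k-j}(x).$$ The Chebyshev polynomials of the second kind are the standard ones, with $U_k(\cos\theta)\sin\theta=\sin((k+1)\theta)$. *)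

theory Defs
  imports Complex_Main "HOL-Computational_Algebra.Polynomial"
begin

definition is_chebyshev_U :: "nat \<Rightarrow> real poly \<Rightarrow> bool" where
  "is_chebyshev_U k p \<longleftrightarrow>
     (\<forall>\<theta>::real. poly p (cos \<theta>) * sin \<theta> = sin ((real k + 1) * \<theta>))"

definition chebyshev_U :: "nat \<Rightarrow> real poly" where
  "chebyshev_U k = (THE p. is_chebyshev_U k p)"

lemma is_chebyshev_U_unique:
  assumes "is_chebyshev_U k p" and "is_chebyshev_U k q"
  shows "p = q"
proof -
  have "poly (p - q) x = 0" if "x \<in> {-1<..<1}" for x :: real
  proof -
    have "cos (arccos x) = x" and "sin (arccos x) \<noteq> 0"
      using that by (auto simp: sin_arccos_nonzero)
    then show ?thesis
      using assms unfolding is_chebyshev_U_def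
      by (metis cancel_comm_monoid_add_class.diff_cancel mult_right_cancel poly_diff)
  qed
  then have "{-1<..<1} \<subseteq> {x. poly (p - q) x = 0}"
    by blast
  moreover have "infinite {-1<..<1::real}"
    by (simp add: infinite_Ioo)
  ultimately have "p - q = 0"
    using poly_roots_finite finite_subset by blast
  then show ?thesis by simp
qed

lemma is_chebyshev_U_exists: "\<exists>p. is_chebyshev_U k p"
proof (induction k rule: less_induct)
  case (less k)
  consider "k = 0" | "k = 1" | m where "k = m + 2"
    by (metis One_nat_def add_2_eq_Suc' not0_implies_Suc)
  then show ?case
  proof cases
    case 1
    then have "is_chebyshev_U k 1" by (simp add: is_chebyshev_U_def)
    then show ?thesis ..
  next
    case 2
    then have "is_chebyshev_U k [:0, 2:]"
      by (simp add: is_chebyshev_U_def sin_double)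
    then show ?thesis ..
  next
    case 3
    obtain p q where p: "is_chebyshev_U m p" and q: "is_chebyshev_U (m + 1) q"
      using less[of m] less[of "m + 1"] 3 by auto
    have "is_chebyshev_U k ([:0, 2:] * q - p)"
      unfolding is_chebyshev_U_def
    proof
      fix \<theta> :: real
      let ?a = "(real m + 2) * \<theta>"
      have p': "poly p (cos \<theta>) * sin \<theta> = sin (?a - \<theta>)"
        using p by (simp add: is_chebyshev_U_def algebra_simps)
      have q': "poly q (cos \<theta>) * sin \<theta> = sin ?a"
        using q by (simp add: is_chebyshev_U_def algebra_simps)
      have "poly ([:0, 2:] * q - p) (cos \<theta>) * sin \<theta> =
          2 * cos \<theta> * (poly q (cos \<theta>) * sin \<theta>) - poly p (cos \<theta>) * sin \<theta>"
        by (simp add: algebra_simps)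
      also have "\<dots> = sin (?a + \<theta>)"
        unfolding p' q' by (simp add: sin_add sin_diff)
      also have "?a + \<theta> = (real k + 1) * \<theta>"
        using 3 by (simp add: algebra_simps)
      finally show "poly ([:0, 2:] * q - p) (cos \<theta>) * sin \<theta> = sin ((real k + 1) * \<theta>)" .
    qed
    then show ?thesis ..
  qed
qed

lemma is_chebyshev_U_chebyshev_U: "is_chebyshev_U k (chebyshev_U k)"
  unfolding chebyshev_U_def
  using is_chebyshev_U_exists is_chebyshev_U_unique by (metis theI)

text \<open>The index subtraction on \<open>nat\<close> never truncates, since \<open>j \<le> 2 * n\<close>.\<close>

definition turan :: "nat \<Rightarrow> nat \<Rightarrow> (nat \<Rightarrow> real poly) \<Rightarrow> real \<Rightarrow> real" where
  "turan n k P x =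
     (\<Sum>j=0..2 * n. (-1) ^ (n + j) / fact (2 * n) * real ((2 * n) choose j)
        * poly (P (j + k)) x * poly (P (2 * n + k - j)) x)"

end

theory Submission imports Defs begin

text \<open>
  For \<open>x = cos \<theta>\<close>, multiply by \<open>sin\<^sup>2 \<theta>\<close>. Each product of two sines becomes half of
  \<open>cos ((2j - 2n)\<theta>) - cos ((2n + 2k + 2)\<theta>)\<close>. The second cosine does not depend on \<open>j\<close>, so it
  cancels in the alternating binomial sum; the first ones sum to \<open>(2 sin \<theta>) ^ 2n\<close> by expanding
  \<open>(cis \<theta> - cis (-\<theta>)) ^ 2n\<close>. Both sides are polynomials in \<open>x\<close>, so agreement on \<open>(-1, 1)\<close> suffices.
\<close>

lemma alternating_binomial_sum_cos:
  "(\<Sum>j\<le>2 * n. (-1) ^ (n + j) * real ((2 * n) choose j) * cos ((2 * real j - 2 * real n) * \<theta>))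
     = (2 * sin \<theta>) ^ (2 * n)"
proof -
  have summand: "(-1) ^ n * (of_nat ((2 * n) choose j) * cis \<theta> ^ j * (- cis (- \<theta>)) ^ (2 * n - j))
      = complex_of_real ((-1) ^ (n + j) * real ((2 * n) choose j)) * cis ((2 * real j - 2 * real n) * \<theta>)"
    if "j \<le> 2 * n" for j
  proof -
    \<comment> \<open>The exponents \<open>2 * n - j\<close> and \<open>j\<close> have the same
      parity.\<close>
    have sgn: "(-1) ^ (2 * n - j) = ((-1) ^ j :: complex)"
      using that by (simp add: minus_one_power_iff)
    have "cis \<theta> ^ j * cis (- \<theta>) ^ (2 * n - j)
        = cis (real j * \<theta> + real (2 * n - j) * - \<theta>)"
      by (simp add: DeMoivre cis_mult)
    also have "real j * \<theta> + real (2 * n - j) * - \<theta> = (2 * real j - 2 * real n) * \<theta>"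
      using that by (simp add: of_nat_diff algebra_simps)
    finally have c: "cis \<theta> ^ j * cis (- \<theta>) ^ (2 * n - j) = cis ((2 * real j - 2 * real n) * \<theta>)" .
    have "(-1) ^ n * (of_nat ((2 * n) choose j) * cis \<theta> ^ j * (- cis (- \<theta>)) ^ (2 * n - j))
        = (-1) ^ n * (-1) ^ (2 * n - j) * of_nat ((2 * n) choose j)
            * (cis \<theta> ^ j * cis (- \<theta>) ^ (2 * n - j))"
      by (simp add: power_minus[of "cis (- \<theta>)"] mult_ac)
    then show ?thesis
      unfolding sgn c by (simp add: power_add)
  qed
  have "cis \<theta> + - cis (- \<theta>) = \<i> * complex_of_real (2 * sin \<theta>)"
    by (simp add: complex_eq_iff)
  \<comment> \<open>The power contributes \<open>\<i> ^ (2 * n)\<close>, which is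
    \<open>(-1) ^ n\<close>; the prefactor \<open>(-1) ^ n\<close> cancels it and accounts for the
    \<open>n\<close> in the sign \<open>(-1) ^ (n + j)\<close>.\<close>
  then have "complex_of_real ((2 * sin \<theta>) ^ (2 * n)) = (-1) ^ n * (cis \<theta> + - cis (- \<theta>)) ^ (2 * n)"
    by (simp add: power_mult_distrib power_mult[of \<i>] flip: power_mult_distrib[of "-1" "-1" n])
  also have "\<dots> = (\<Sum>j\<le>2 * n. complex_of_real ((-1) ^ (n + j) * real ((2 * n) choose j))
      * cis ((2 * real j - 2 * real n) * \<theta>))"
    unfolding binomial_ring sum_distrib_left by (intro sum.cong refl summand) simp
  finally have "Re (complex_of_real ((2 * sin \<theta>) ^ (2 * n)))
      = Re (\<Sum>j\<le>2 * n. complex_of_real ((-1) ^ (n + j) * real ((2 * n) choose j))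
          * cis ((2 * real j - 2 * real n) * \<theta>))"
    by (rule arg_cong)
  then show ?thesis
    by (simp only: Re_sum Re_complex_of_real scaleR_conv_of_real[symmetric] scaleR_complex.simps cis.simps)
qed

text \<open>The square of the sine supplies one factor for each of the two Chebyshev values. Keeping
  it on the left avoids division, so zeros of the sine need no separate case.\<close>

lemma turan_chebyshev_U_cos:
  assumes "n \<ge> 1"
  shows "turan n k chebyshev_U (cos \<theta>) * (sin \<theta>)\<^sup>2 = (2 * sin \<theta>) ^ (2 * n) / (2 * fact (2 * n))"
proof -
  let ?c = "\<lambda>j. (-1) ^ (n + j) * real ((2 * n) choose j)"
  let ?w = "cos ((2 * real n + 2 * real k + 2) * \<theta>)"
  have "(\<Sum>j\<le>2 * n. ?c j) = (-1) ^ n * (\<Sum>j\<le>2 * n. (-1) ^ j * real ((2 * n) choose j))"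
    by (simp add: sum_distrib_left power_add mult_ac)
  \<comment> \<open>Here \<open>n \<ge> 1\<close> matters: row 0 of Pascal's triangle has
    alternating sum 1, every later row has 0.\<close>
  then have c0: "(\<Sum>j\<le>2 * n. ?c j) = 0"
    using assms choose_alternating_sum[of "2 * n", where 'a = real] by simp
  have "(-1) ^ (n + j) / fact (2 * n) * real ((2 * n) choose j)
        * poly (chebyshev_U (j + k)) (cos \<theta>) * poly (chebyshev_U (2 * n + k - j)) (cos \<theta>) * (sin \<theta>)\<^sup>2
      = (?c j * cos ((2 * real j - 2 * real n) * \<theta>) - ?c j * ?w) / (2 * fact (2 * n))"
    if "j \<le> 2 * n" for j
  proof -
    let ?a = "(real (j + k) + 1) * \<theta>" and ?b = "(real (2 * n + k - j) + 1) * \<theta>"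
    have U: "poly (chebyshev_U m) (cos \<theta>) * sin \<theta> = sin ((real m + 1) * \<theta>)" for m
      using is_chebyshev_U_chebyshev_U by (simp add: is_chebyshev_U_def)
    \<comment> \<open>The indices \<open>j + k\<close> and \<open>2 * n + k - j\<close> add up to
      \<open>2 * n + 2 * k\<close>, and the two shifts by one give the final 2; hence the sum of the
      angles is free of \<open>j\<close>.\<close>
    have ab: "?a - ?b = (2 * real j - 2 * real n) * \<theta>"
      "?a + ?b = (2 * real n + 2 * real k + 2) * \<theta>"
      using that by (simp_all add: of_nat_diff algebra_simps)
    have "(-1) ^ (n + j) / fact (2 * n) * real ((2 * n) choose j)
          * poly (chebyshev_U (j + k)) (cos \<theta>) * poly (chebyshev_U (2 * n + k - j)) (cos \<theta>) * (sin \<theta>)\<^sup>2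
        = ?c j / fact (2 * n) * ((poly (chebyshev_U (j + k)) (cos \<theta>) * sin \<theta>)
            * (poly (chebyshev_U (2 * n + k - j)) (cos \<theta>) * sin \<theta>))"
      by (simp add: power2_eq_square)
    also have "\<dots> = ?c j / fact (2 * n) * ((cos (?a - ?b) - cos (?a + ?b)) / 2)"
      unfolding U sin_times_sin ..
    also have "\<dots> = (?c j * cos ((2 * real j - 2 * real n) * \<theta>) - ?c j * ?w) / (2 * fact (2 * n))"
      unfolding ab by (simp add: field_simps)
    finally show ?thesis .
  qed
  then have "turan n k chebyshev_U (cos \<theta>) * (sin \<theta>)\<^sup>2
      = (\<Sum>j\<le>2 * n. (?c j * cos ((2 * real j - 2 * real n) * \<theta>) - ?c j * ?w) / (2 * fact (2 * n)))"
    unfolding turan_def sum_distrib_right atLeast0AtMost by (intro sum.cong) auto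
  also have "\<dots> = ((\<Sum>j\<le>2 * n. ?c j * cos ((2 * real j - 2 * real n) * \<theta>))
      - (\<Sum>j\<le>2 * n. ?c j) * ?w) / (2 * fact (2 * n))"
    by (simp add: sum_subtractf sum_distrib_right flip: sum_divide_distrib)
  finally show ?thesis
    unfolding c0 alternating_binomial_sum_cos by simp
qed

text \<open>\<open>turan\<close> is defined pointwise; a polynomial representing it makes the
  finiteness of root sets available.\<close>

lemma turan_eq_poly: "\<exists>p. \<forall>x. turan n k P x = poly p x"
proof -
  have "turan n k P x = poly (\<Sum>j=0..2 * n. smult ((-1) ^ (n + j) / fact (2 * n) * real ((2 * n) choose j))
      (P (j + k) * P (2 * n + k - j))) x" for x
    by (simp add: turan_def poly_sum mult.assoc)
  then show ?thesis by blast
qed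

theorem proposition4p2:
  fixes n k :: nat and x :: real
  assumes "n \<ge> 1"
  shows "turan n k chebyshev_U x = 2 ^ (2 * n - 1) / fact (2 * n) * (1 - x\<^sup>2) ^ (n - 1)"
proof -
  obtain p where p: "\<And>x. turan n k chebyshev_U x = poly p x"
    using turan_eq_poly by blast
  let ?q = "smult (2 ^ (2 * n - 1) / fact (2 * n)) ([:1, 0, -1:] ^ (n - 1)) :: real poly"
  have q: "poly ?q x = 2 ^ (2 * n - 1) / fact (2 * n) * (1 - x\<^sup>2) ^ (n - 1)" for x
    by (simp add: power2_eq_square)
  \<comment> \<open>The endpoints are left out because the sine vanishes there and could not be
    cancelled.\<close>
  have "poly (p - ?q) y = 0" if "y \<in> {-1<..<1}" for y
  proof -
    obtain m where m: "n = Suc m"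
      using assms by (cases n) auto
    define \<theta> where "\<theta> = arccos y"
    have y: "cos \<theta> = y" and s: "sin \<theta> \<noteq> 0"
      using that by (auto simp: \<theta>_def sin_arccos_nonzero)
    have s2: "(sin \<theta>)\<^sup>2 = 1 - y\<^sup>2"
      by (simp add: sin_squared_eq y)
    \<comment> \<open>One factor 2 is split off to meet the 2 in the denominator of
      \<open>turan_chebyshev_U_cos\<close>, and one squared sine to be cancelled. With
      \<open>n = Suc m\<close> neither \<open>2 * n - 1\<close> nor \<open>n - 1\<close>
      truncates.\<close>
    have "(2 * sin \<theta>) ^ (2 * n) = 2 * 2 ^ (2 * n - 1) * (1 - y\<^sup>2) ^ (n - 1) * (sin \<theta>)\<^sup>2"
      unfolding m by (simp add: power_mult_distrib power_mult flip: s2 power2_eq_square)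
    then have "poly p y * (sin \<theta>)\<^sup>2 = poly ?q y * (sin \<theta>)\<^sup>2"
      using turan_chebyshev_U_cos[OF assms, of k \<theta>] unfolding y p q by simp
    then have "poly p y = poly ?q y" using mult_right_cancel[OF power_not_zero[OF s]] by blast
    then show ?thesis by simp
  qed
  then have "{-1<..<1} \<subseteq> {x. poly (p - ?q) x = 0}"
    by blast
  \<comment> \<open>A nonzero polynomial has finitely many roots, so the interval forces
    \<open>p = ?q\<close>, and the identity extends to all real \<open>x\<close>.\<close>
  then have "infinite {x. poly (p - ?q) x = 0}"
    by (rule infinite_super) (simp add: infinite_Ioo)
  then have "p = ?q"
    using poly_roots_finite[of "p - ?q"] by (metis right_minus_eq)
  then have "poly p x = poly ?q x"
    by (rule arg_cong)
  then show ?thesis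
    unfolding p q .
qed

end
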